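(* Let $\mathbb F\in\{\mathbb R,\mathbb C\}$ and let $\mathcal X$ and $\mathcal Y$ be BJ-normed spaces over $\mathbb F$. If $\Gamma_0(\mathcal X)$ and $\Gamma_0(\mathcal Y)$ are isomorphic, then $\Gamma(\mathcal X)$ and $\Gamma(\mathcal Y)$ are also isomorphic.
   Context: For $u,v$ in a normed space $\mathcal X$ over $\mathbb F$, $u\perp v$ (Birkhoff--James orthogonality) means $\|u+\lambda v\|\ge\|u\|$ for all $\lambda\in\mathbb F$. $\Gamma_0(\mathcal X)$ is the directed graph whose vertices are all vectors of $\mathcal X$, with an edge $u\rightarrow v$ if and only if $u\perp v$. $\Gamma(\mathcal X)$ is the directed graph whose vertices are the one-dimensional subspaces $[u]=\mathbb F u$, $u\ne0$, with an edge $[u]\rightarrow[v]$ if and only if $u\perp v$. Isomorphism of digraphs means a bijection of vertices preserving edges in both directions. For a vector $u$, $u^\perp=\{v : u\perp v\}$ and ${}^\perp u=\{v : v\perp u\}$. Elements $u,v$ are BJ-equivalent if $u^\perp=v^\perp$ and ${}^\perp u={}^\perp v$. A norm is a BJ-norm (and the space is BJ-normed) if BJ-equivalent elements are always linearly dependent. *)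

theory Defs
  imports "HOL-Analysis.Analysis" "Graph_Theory.Graph_Theory"
begin

text \<open>
  A normed space over the field \<open>'k\<close>, used for \<open>'k = real\<close> and \<open>'k = complex\<close>. The class
  \<open>real_normed_vector\<close> supplies addition, the norm and the underlying real structure;
  \<open>scale\<close> is the multiplication by scalars of \<open>'k\<close>, which extends \<open>scaleR\<close>. Over the reals this
  leaves \<open>scale = scaleR\<close> as the only choice.
\<close>

locale normed_space_over = vector_space scale
  for scale :: "'k::real_normed_field \<Rightarrow> 'a::real_normed_vector \<Rightarrow> 'a" +
  assumes scale_of_real: "scale (of_real r) x = r *\<^sub>R x"
    and norm_scale: "norm (scale c x) = norm c * norm x"

definition bj_orth ::
    "('k::real_normed_field \<Rightarrow> 'a::real_normed_vector \<Rightarrow> 'a) \<Rightarrow> 'a \<Rightarrow> 'a \<Rightarrow> bool" where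
  "bj_orth sc u v \<longleftrightarrow> (\<forall>l. norm (u + sc l v) \<ge> norm u)"

definition bj_equiv ::
    "('k::real_normed_field \<Rightarrow> 'a::real_normed_vector \<Rightarrow> 'a) \<Rightarrow> 'a \<Rightarrow> 'a \<Rightarrow> bool" where
  "bj_equiv sc u v \<longleftrightarrow>
     {w. bj_orth sc u w} = {w. bj_orth sc v w} \<and>
     {w. bj_orth sc w u} = {w. bj_orth sc w v}"

text \<open>
  Linear dependence in the axiom below is that of the family \<open>(u, v)\<close>. The set-based
  \<open>dependent {u, v}\<close> would be wrong for \<open>u = v \<noteq> 0\<close>, where the set is a singleton.
\<close>

locale BJ_normed_space = normed_space_over scale
  for scale :: "'k::real_normed_field \<Rightarrow> 'a::real_normed_vector \<Rightarrow> 'a" +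
  assumes bj_equiv_imp_dependent:
    "bj_equiv scale u v \<Longrightarrow> \<exists>a b. (a \<noteq> 0 \<or> b \<noteq> 0) \<and> scale a u + scale b v = 0"

definition bj_digraph_vec ::
    "('k::real_normed_field \<Rightarrow> 'a::real_normed_vector \<Rightarrow> 'a) \<Rightarrow> 'a pair_pre_digraph" where
  "bj_digraph_vec sc = \<lparr> pverts = UNIV, parcs = {(u, v). bj_orth sc u v} \<rparr>"

definition scalar_line :: "('k::real_normed_field \<Rightarrow> 'a::real_normed_vector \<Rightarrow> 'a) \<Rightarrow> 'a \<Rightarrow> 'a set" where
  "scalar_line sc u = range (\<lambda>c. sc c u)"

definition bj_digraph_line ::
    "('k::real_normed_field \<Rightarrow> 'a::real_normed_vector \<Rightarrow> 'a) \<Rightarrow> 'a set pair_pre_digraph" where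
  "bj_digraph_line sc =
     \<lparr> pverts = {scalar_line sc u | u. u \<noteq> 0},
       parcs = {(scalar_line sc u, scalar_line sc v) | u v. u \<noteq> 0 \<and> v \<noteq> 0 \<and> bj_orth sc u v} \<rparr>"

lemma normed_space_over_scaleR:
  "normed_space_over (scaleR :: real \<Rightarrow> 'a::real_normed_vector \<Rightarrow> 'a)"
  by unfold_locales (auto simp: algebra_simps)

lemma pair_wf_digraph_bj_digraph_vec: "pair_wf_digraph (bj_digraph_vec sc)"
  by unfold_locales (auto simp: bj_digraph_vec_def)

lemma pair_wf_digraph_bj_digraph_line: "pair_wf_digraph (bj_digraph_line sc)"
  by unfold_locales (auto simp: bj_digraph_line_def)

text \<open>Edges of \<open>bj_digraph_line\<close> do not depend on the vectors chosen to represent the lines.\<close>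

context normed_space_over
begin

lemma bj_orth_scale:
  assumes "c \<noteq> 0" "d \<noteq> 0"
  shows "bj_orth scale (scale c u) (scale d v) \<longleftrightarrow> bj_orth scale u v"
proof -
  have key: "norm (scale c u + scale l (scale d v)) = norm c * norm (u + scale (l * d / c) v)" for l
  proof -
    have "scale c u + scale l (scale d v) = scale c (u + scale (l * d / c) v)"
      using assms by (simp add: scale_right_distrib)
    then show ?thesis by (simp add: norm_scale)
  qed
  have "bj_orth scale (scale c u) (scale d v) \<longleftrightarrow> (\<forall>l. norm u \<le> norm (u + scale (l * d / c) v))"
    unfolding bj_orth_def key norm_scale using assms by simp
  also have "\<dots> \<longleftrightarrow> bj_orth scale u v"
    unfolding bj_orth_def
  proof safe
    fix l assume "\<forall>l. norm u \<le> norm (u + scale (l * d / c) v)"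
    then have "norm u \<le> norm (u + scale ((l * c / d) * d / c) v)" by blast
    then show "norm u \<le> norm (u + scale l v)" using assms by simp
  qed blast
  finally show ?thesis .
qed

lemma scalar_line_eqD:
  assumes "scalar_line scale u = scalar_line scale v" "u \<noteq> 0"
  obtains c where "c \<noteq> 0" "u = scale c v"
proof -
  have "u \<in> scalar_line scale u" unfolding scalar_line_def by (metis rangeI scale_one)
  then obtain c where "u = scale c v" using assms by (auto simp: scalar_line_def)
  with that assms(2) show ?thesis by (metis scale_zero_left)
qed

lemma bj_digraph_line_edge_iff:
  assumes "u \<noteq> 0" "v \<noteq> 0"
  shows "(scalar_line scale u, scalar_line scale v) \<in> parcs (bj_digraph_line scale) \<longleftrightarrow> bj_orth scale u v"
proof
  assume "(scalar_line scale u, scalar_line scale v) \<in> parcs (bj_digraph_line scale)"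
  then obtain u' v' where *: "scalar_line scale u = scalar_line scale u'" "scalar_line scale v = scalar_line scale v'"
      "bj_orth scale u' v'"
    by (auto simp: bj_digraph_line_def)
  obtain c d where "c \<noteq> 0" "u = scale c u'" "d \<noteq> 0" "v = scale d v'"
    using scalar_line_eqD[OF *(1) assms(1)] scalar_line_eqD[OF *(2) assms(2)] by metis
  with *(3) show "bj_orth scale u v" by (simp add: bj_orth_scale)
qed (use assms in \<open>auto simp: bj_digraph_line_def\<close>)

end

text \<open>
  For digraphs without parallel arcs, the isomorphism notion \<open>digraph_iso\<close> of the library amounts
  to a bijection of the vertices that preserves edges in both directions.
\<close>

lemma digraph_iso_with_proj_iff:
  assumes G: "pair_wf_digraph G" and H: "pair_wf_digraph H"
  shows "digraph_iso (with_proj G) (with_proj H) \<longleftrightarrow>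
    (\<exists>f. bij_betw f (pverts G) (pverts H) \<and>
      (\<forall>u\<in>pverts G. \<forall>v\<in>pverts G. (u, v) \<in> parcs G \<longleftrightarrow> (f u, f v) \<in> parcs H))" (is "?L \<longleftrightarrow> ?R")
proof
  interpret G: pair_wf_digraph G by fact
  assume ?L
  then obtain h where h: "pre_digraph.digraph_isomorphism (with_proj G) h"
      "with_proj H = app_iso h (with_proj G)"
    by (auto simp: digraph_iso_def)
  let ?f = "iso_verts h"
  have inj: "inj_on ?f (pverts G)"
    and ends: "\<And>a. a \<in> parcs G \<Longrightarrow>
      ?f (fst a) = iso_tail h (iso_arcs h a) \<and> ?f (snd a) = iso_head h (iso_arcs h a)"
    using h(1) by (auto simp: pre_digraph.digraph_isomorphism_def)
  have V: "pverts H = ?f ` pverts G" and A: "parcs H = iso_arcs h ` parcs G"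
    and T: "fst = iso_tail h" "snd = iso_head h"
    using arg_cong[OF h(2), of verts] arg_cong[OF h(2), of arcs]
      arg_cong[OF h(2), of tail] arg_cong[OF h(2), of head] by auto
  have arc: "iso_arcs h a = (?f (fst a), ?f (snd a))" if "a \<in> parcs G" for a
    using ends[OF that] T by (metis prod.collapse)
  have "(u, v) \<in> parcs G \<longleftrightarrow> (?f u, ?f v) \<in> parcs H" if uv: "u \<in> pverts G" "v \<in> pverts G" for u v
  proof
    assume "(u, v) \<in> parcs G" then show "(?f u, ?f v) \<in> parcs H"
      unfolding A using arc by (metis fst_conv image_eqI snd_conv)
  next
    assume "(?f u, ?f v) \<in> parcs H"
    then obtain a where a: "a \<in> parcs G" "(?f u, ?f v) = (?f (fst a), ?f (snd a))"
      unfolding A using arc by auto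
    then have "u = fst a" "v = snd a"
      using inj uv G.arc_fst_in_verts G.arc_snd_in_verts by (auto dest: inj_onD)
    with a(1) show "(u, v) \<in> parcs G" by simp
  qed
  with inj V show ?R by (auto simp: bij_betw_def)
next
  interpret G: pair_wf_digraph G by fact
  interpret H: pair_wf_digraph H by fact
  assume ?R
  then obtain f where f: "inj_on f (pverts G)" "pverts H = f ` pverts G"
    and e: "\<And>u v. u \<in> pverts G \<Longrightarrow> v \<in> pverts G \<Longrightarrow> (u, v) \<in> parcs G \<longleftrightarrow> (f u, f v) \<in> parcs H"
    by (auto simp: bij_betw_def)
  let ?h = "\<lparr> iso_verts = f, iso_arcs = map_prod f f, iso_head = snd, iso_tail = fst \<rparr>"
  have sub: "parcs G \<subseteq> pverts G \<times> pverts G"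
    by (auto dest: G.in_arcsD1 G.in_arcsD2)
  have "inj_on (map_prod f f) (parcs G)"
    using map_prod_inj_on[OF f(1) f(1)] sub by (rule inj_on_subset)
  moreover have "wf_digraph (with_proj G)" by unfold_locales
  ultimately have "pre_digraph.digraph_isomorphism (with_proj G) ?h"
    using f(1) by (auto simp: pre_digraph.digraph_isomorphism_def)
  moreover have "parcs H = map_prod f f ` parcs G"
  proof (intro set_eqI iffI)
    fix a assume a: "a \<in> parcs H"
    then obtain u v where uv: "u \<in> pverts G" "v \<in> pverts G" "a = (f u, f v)"
      using H.arc_fst_in_verts[OF a] H.arc_snd_in_verts[OF a] f(2) by (metis imageE prod.collapse)
    then show "a \<in> map_prod f f ` parcs G" using a e by (metis map_prod_imageI)
  next
    fix a assume "a \<in> map_prod f f ` parcs G"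
    then show "a \<in> parcs H" using sub e by auto
  qed
  then have "with_proj H = app_iso ?h (with_proj G)"
    using f(2) by (simp add: app_iso_def with_proj_def)
  ultimately show ?L unfolding digraph_iso_def by blast
qed

end

theory Submission
  imports Defs
begin

text \<open>
  The zero vector is the only vertex of the vector graph with a loop, so an isomorphism of vector
  graphs fixes it. In a BJ-normed space two nonzero vectors span the same line if and only if they
  are BJ-equivalent, and BJ-equivalence is visible in the graph; hence the isomorphism descends to
  lines.
\<close>

context normed_space_over
begin

lemma bj_orth_self_iff: "bj_orth scale u u \<longleftrightarrow> u = 0"
proof
  assume "bj_orth scale u u"
  \<comment> \<open>The scalar -1 turns the right-hand side into 0.\<close>
  then have "norm u \<le> norm (u + scale (-1) u)" unfolding bj_orth_def by blast
  then show "u = 0" by simp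
qed (simp add: bj_orth_def)

lemma scalar_line_scale:
  assumes "c \<noteq> 0"
  shows "scalar_line scale (scale c u) = scalar_line scale u"
proof -
  have "scale d u \<in> scalar_line scale (scale c u)" for d
    unfolding scalar_line_def by (rule range_eqI[of _ _ "d / c"]) (use assms in simp)
  then show ?thesis by (auto simp: scalar_line_def)
qed

lemma bj_equiv_scale:
  assumes "c \<noteq> 0"
  shows "bj_equiv scale (scale c u) u"
  \<comment> \<open>The factor 1 leaves one argument alone: the first instance rescales the left
    argument, for out-neighbours, the second the right one, for in-neighbours.\<close>
  using bj_orth_scale[OF assms, of 1 u] bj_orth_scale[OF _ assms, of 1 _ u]
  by (simp add: bj_equiv_def)

end

text \<open>Homogeneity of orthogonality gives one direction; the other is the BJ-norm
  axiom.\<close>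

lemma (in BJ_normed_space) scalar_line_eq_iff_bj_equiv:
  assumes "u \<noteq> 0" "v \<noteq> 0"
  shows "scalar_line scale u = scalar_line scale v \<longleftrightarrow> bj_equiv scale u v"
proof
  assume "scalar_line scale u = scalar_line scale v"
  then obtain c where "c \<noteq> 0" "u = scale c v"
    using assms(1) by (rule scalar_line_eqD)
  then show "bj_equiv scale u v" by (simp add: bj_equiv_scale)
next
  assume "bj_equiv scale u v"
  then obtain a b where ab: "a \<noteq> 0 \<or> b \<noteq> 0" "scale a u + scale b v = 0"
    using bj_equiv_imp_dependent by blast
  \<comment> \<open>If one coefficient vanished, the relation would force a nonzero vector to be
    0.\<close>
  with assms have nz: "a \<noteq> 0" "b \<noteq> 0" by auto
  have "scale a u = scale (- b) v"
    using ab(2) by (simp add: eq_neg_iff_add_eq_0)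
  then show "scalar_line scale u = scalar_line scale v"
    using nz by (metis scalar_line_scale neg_equal_0_iff_equal)
qed

text \<open>A graph isomorphism is a mere bijection of vertices, so the scalars of the two spaces
  never interact and may come from different fields. The real and the complex case are both
  instances.\<close>

theorem digraph_iso_bj_digraph_line:
  fixes sX :: "'k::real_normed_field \<Rightarrow> 'a::real_normed_vector \<Rightarrow> 'a"
    and sY :: "'l::real_normed_field \<Rightarrow> 'b::real_normed_vector \<Rightarrow> 'b"
  assumes "BJ_normed_space sX" "BJ_normed_space sY"
    and iso: "digraph_iso (with_proj (bj_digraph_vec sX)) (with_proj (bj_digraph_vec sY))"
  shows "digraph_iso (with_proj (bj_digraph_line sX)) (with_proj (bj_digraph_line sY))"
proof -
  interpret X: BJ_normed_space sX by fact
  interpret Y: BJ_normed_space sY by fact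
  obtain f where bij: "bij f" and orth: "\<And>u v. bj_orth sX u v \<longleftrightarrow> bj_orth sY (f u) (f v)"
    using iso
    unfolding digraph_iso_with_proj_iff[OF pair_wf_digraph_bj_digraph_vec pair_wf_digraph_bj_digraph_vec]
    by (auto simp: bj_digraph_vec_def)
  have f0: "f u = 0 \<longleftrightarrow> u = 0" for u
    using orth[of u u] by (simp add: X.bj_orth_self_iff Y.bj_orth_self_iff)
  have surj: "surj f" using bij by (rule bij_is_surj)
  \<comment> \<open>Surjectivity of \<open>f\<close> lets the neighbours quantified over in the
    second space be taken as images \<open>f w\<close>.\<close>
  have all_f: "(\<forall>w. P (f w)) \<longleftrightarrow> (\<forall>w. P w)" for P
    using surj by (metis surjD)
  have "bj_equiv sX u v \<longleftrightarrow> bj_equiv sY (f u) (f v)" for u v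
    using all_f[of "\<lambda>w. bj_orth sY (f u) w \<longleftrightarrow> bj_orth sY (f v) w"]
      all_f[of "\<lambda>w. bj_orth sY w (f u) \<longleftrightarrow> bj_orth sY w (f v)"]
    by (simp add: bj_equiv_def set_eq_iff orth)
  \<comment> \<open>Left to right makes the induced map on lines well defined, right to left makes
    it injective.\<close>
  then have line_iff: "scalar_line sX u = scalar_line sX v \<longleftrightarrow> scalar_line sY (f u) = scalar_line sY (f v)"
    if "u \<noteq> 0" "v \<noteq> 0" for u v
    using that by (simp add: X.scalar_line_eq_iff_bj_equiv Y.scalar_line_eq_iff_bj_equiv f0)
  define g where "g L = scalar_line sY (f (SOME u. u \<noteq> 0 \<and> L = scalar_line sX u))" for L
  have g: "g (scalar_line sX u) = scalar_line sY (f u)" if "u \<noteq> 0" for u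
  proof -
    let ?v = "SOME v. v \<noteq> 0 \<and> scalar_line sX u = scalar_line sX v"
    have "?v \<noteq> 0 \<and> scalar_line sX u = scalar_line sX ?v"
      by (rule someI[of _ u]) (use that in simp)
    \<comment> \<open>The chosen \<open>?v\<close> may differ from \<open>u\<close> but spans the
      same line, so its image spans the same line as \<open>f u\<close>.\<close>
    with that line_iff show ?thesis unfolding g_def by metis
  qed
  have V: "pverts (bj_digraph_line sX) = {scalar_line sX u | u. u \<noteq> 0}"
    "pverts (bj_digraph_line sY) = {scalar_line sY u | u. u \<noteq> 0}"
    by (simp_all add: bj_digraph_line_def)
  have "bij_betw g (pverts (bj_digraph_line sX)) (pverts (bj_digraph_line sY))"
    unfolding bij_betw_def
  proof
    show "inj_on g (pverts (bj_digraph_line sX))"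
    proof (rule inj_onI)
      fix K L assume KL: "K \<in> pverts (bj_digraph_line sX)" "L \<in> pverts (bj_digraph_line sX)" "g K = g L"
      then obtain u v where uv: "u \<noteq> 0" "K = scalar_line sX u" "v \<noteq> 0" "L = scalar_line sX v"
        unfolding V by blast
      with KL(3) show "K = L" by (simp add: g line_iff)
    qed
    show "g ` pverts (bj_digraph_line sX) = pverts (bj_digraph_line sY)"
    proof
      show "g ` pverts (bj_digraph_line sX) \<subseteq> pverts (bj_digraph_line sY)"
        using f0 by (auto simp: V g)
      show "pverts (bj_digraph_line sY) \<subseteq> g ` pverts (bj_digraph_line sX)"
      proof
        fix L assume "L \<in> pverts (bj_digraph_line sY)"
        then obtain w where "w \<noteq> 0" "L = scalar_line sY w"
          unfolding V by blast
        moreover obtain u where "w = f u" using surj by (rule surjE)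
        \<comment> \<open>A preimage of a nonzero vector is nonzero by \<open>f0\<close>, so it
          spans a line.\<close>
        ultimately have "u \<noteq> 0" "L = scalar_line sY (f u)" by (simp_all add: f0)
        then show "L \<in> g ` pverts (bj_digraph_line sX)"
          unfolding V by (intro image_eqI[of _ _ "scalar_line sX u"]) (auto simp: g)
      qed
    qed
  qed
  moreover have "(K, L) \<in> parcs (bj_digraph_line sX) \<longleftrightarrow> (g K, g L) \<in> parcs (bj_digraph_line sY)"
    if "K \<in> pverts (bj_digraph_line sX)" "L \<in> pverts (bj_digraph_line sX)" for K L
  proof -
    from that obtain u v where "u \<noteq> 0" "K = scalar_line sX u" "v \<noteq> 0" "L = scalar_line sX v"
      unfolding V by blast
    \<comment> \<open>Edges between lines can be tested on any nonzero representatives: here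
      \<open>u\<close>, \<open>v\<close> and their images, nonzero by \<open>f0\<close>.\<close>
    then show ?thesis
      by (simp add: g f0 X.bj_digraph_line_edge_iff Y.bj_digraph_line_edge_iff orth)
  qed
  ultimately show ?thesis
    unfolding digraph_iso_with_proj_iff[OF pair_wf_digraph_bj_digraph_line pair_wf_digraph_bj_digraph_line]
    by blast
qed

text \<open>Over the reals the scalar multiplication is determined, hence \<open>scaleR\<close>; a
  complex one is extra structure on the real normed space, hence the quantified \<open>sX\<close>
  and \<open>sY\<close>.\<close>

theorem lemma3p7:
  shows "(BJ_normed_space (scaleR :: real \<Rightarrow> 'a::real_normed_vector \<Rightarrow> 'a) \<longrightarrow>
      BJ_normed_space (scaleR :: real \<Rightarrow> 'b::real_normed_vector \<Rightarrow> 'b) \<longrightarrow>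
      digraph_iso (with_proj (bj_digraph_vec (scaleR :: real \<Rightarrow> 'a \<Rightarrow> 'a)))
        (with_proj (bj_digraph_vec (scaleR :: real \<Rightarrow> 'b \<Rightarrow> 'b))) \<longrightarrow>
      digraph_iso (with_proj (bj_digraph_line (scaleR :: real \<Rightarrow> 'a \<Rightarrow> 'a)))
        (with_proj (bj_digraph_line (scaleR :: real \<Rightarrow> 'b \<Rightarrow> 'b)))) \<and>
    (\<forall>(sX :: complex \<Rightarrow> 'c::real_normed_vector \<Rightarrow> 'c) (sY :: complex \<Rightarrow> 'd::real_normed_vector \<Rightarrow> 'd).
      BJ_normed_space sX \<longrightarrow>
      BJ_normed_space sY \<longrightarrow>
      digraph_iso (with_proj (bj_digraph_vec sX)) (with_proj (bj_digraph_vec sY)) \<longrightarrow>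
      digraph_iso (with_proj (bj_digraph_line sX)) (with_proj (bj_digraph_line sY)))"
  by (intro conjI allI impI digraph_iso_bj_digraph_line)

end
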